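(* Let $f(x)=\sum_{j=0}^n a_jx^j$ be a polynomial of degree $n\ge 0$ with real coefficients and with $a_0>0$. Then $f$ is stable if and only if its infinite Hurwitz matrix $H(f)$ is a product of the form $$H(f)=J(c_1)\cdots J(c_n)\,H(b)$$ with all parameters $c_j$, $j=1,\ldots,n$, positive real numbers, and $b$ a positive polynomial of degree $0$ (i.e. a positive real constant).
   Context: A polynomial $f$ is called stable if, for $z\in\mathbb{C}$, $f(z)=0$ implies $\operatorname{Re} z<0$. For a polynomial $f(x)=\sum_{j=0}^n a_jx^j$, set $a_i:=0$ for $i<0$ and for $i>n$. The infinite Hurwitz matrix of $f$, with rows and columns indexed by $1,2,3,\ldots$, is $$H(f):=\begin{pmatrix} a_0&a_2&a_4&a_6&\cdots\\ 0&a_1&a_3&a_5&\cdots\\ 0&a_0&a_2&a_4&\cdots\\ 0&0&a_1&a_3&\cdots\\ \vdots&\vdots&\vdots&\vdots&\ddots\end{pmatrix},$$ that is, $H(f)_{2k-1,j}=a_{2(j-k)}$ and $H(f)_{2k,j}=a_{2(j-k)-1}$ for all $k,j\ge 1$. The same definition applies to a constant polynomial $b$. For a real number $c$, $J(c)$ is the infinite matrix $$J(c):=\begin{pmatrix} c&1&0&0&0&\cdots\\ 0&0&1&0&0&\cdots\\ 0&0&c&1&0&\cdots\\ 0&0&0&0&1&\cdots\\ 0&0&0&0&c&\cdots\\ \vdots&\vdots&\vdots&\vdots&\vdots&\ddots\end{pmatrix},$$ that is, for all $k\ge1$, $J(c)_{2k-1,2k-1}=c$, $J(c)_{2k-1,2k}=1$,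 $J(c)_{2k,2k+1}=1$, and all other entries are $0$. Each row of $J(c)$ has finitely many nonzero entries, so the matrix products are well defined entrywise. For $n=0$ the product of the $J$'s is empty and the factorization reads $H(f)=H(b)$. *)

theory Defs
  imports Complex_Main "HOL-Computational_Algebra.Polynomial"
begin

definition hurwitz_stable :: "complex poly \<Rightarrow> bool" where
  "hurwitz_stable p \<longleftrightarrow> (\<forall>z. poly p z = 0 \<longrightarrow> Re z < 0)"

text \<open>
  Infinite matrices are functions on pairs of natural numbers. Rows and columns are counted
  from 0, so the entry written \<open>(i, j)\<close> with \<open>i, j \<ge> 1\<close> on paper is the entry \<open>(i - 1, j - 1)\<close> here.
\<close>

type_synonym inf_matrix = "nat \<Rightarrow> nat \<Rightarrow> real"

definition int_coeff :: "real poly \<Rightarrow> int \<Rightarrow> real" where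
  "int_coeff p m = (if m < 0 then 0 else coeff p (nat m))"

definition hurwitz_matrix :: "real poly \<Rightarrow> inf_matrix" where
  "hurwitz_matrix p i j = int_coeff p (2 * int j - int i)"

definition J_matrix :: "real \<Rightarrow> inf_matrix" where
  "J_matrix c i j = (if j = i + 1 then 1 else if j = i \<and> even i then c else 0)"

text \<open>
  The product is only meaningful when every row of the left factor has finitely many
  nonzero entries.
\<close>

definition inf_matrix_mult :: "inf_matrix \<Rightarrow> inf_matrix \<Rightarrow> inf_matrix" (infixr "\<odot>\<^sub>\<infinity>" 70) where
  "(A \<odot>\<^sub>\<infinity> B) i j = (\<Sum>k | A i k \<noteq> 0. A i k * B k j)"

text \<open>The same matrices with the usual indices \<open>k, j \<ge> 1\<close>, each shifted down by one.\<close>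

lemma hurwitz_matrix_one_based:
  assumes "k \<ge> 1" "j \<ge> 1"
  shows "hurwitz_matrix p ((2 * k - 1) - 1) (j - 1) = int_coeff p (2 * (int j - int k))"
    and "hurwitz_matrix p (2 * k - 1) (j - 1) = int_coeff p (2 * (int j - int k) - 1)"
  using assms by (simp_all add: hurwitz_matrix_def of_nat_diff algebra_simps)

lemma J_matrix_one_based:
  assumes "k \<ge> 1" "j \<ge> 1"
  shows "J_matrix c ((2 * k - 1) - 1) (j - 1) =
           (if j = 2 * k - 1 then c else if j = 2 * k then 1 else 0)"
    and "J_matrix c (2 * k - 1) (j - 1) = (if j = 2 * k + 1 then 1 else 0)"
  using assms by (auto simp: J_matrix_def)

lemma J_matrix_row_finite: "finite {k. J_matrix c i k \<noteq> 0}"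
  by (rule finite_subset[of _ "{i, i + 1}"]) (auto simp: J_matrix_def)

end

theory Submission
  imports Defs
    "HOL-Computational_Algebra.Fundamental_Theorem_Algebra"
    "HOL-Analysis.Convex"
begin

text \<open>
  Comparing entries, \<open>J(c) H(g) = H(f)\<close> says exactly that \<open>f(x) = x g(x) + c g\<^sub>e(x)\<close>, where
  \<open>g\<^sub>e\<close> is the even part of \<open>g\<close> (\<open>hurwitz_matrix_raise\<close>). Since \<open>f\<close> can be read off from \<open>H(f)\<close>,
  the theorem becomes a statement about polynomials: the stable polynomials with positive constant
  term are those obtained from a positive constant by steps \<open>g \<mapsto> x g + c g\<^sub>e\<close> with \<open>c > 0\<close>.
  A step raises the degree by one, and it can be undone as soon as \<open>f\<close> has a nonzero linear
  coefficient, with the forced choice \<open>c = f\<^sub>0 / f\<^sub>1\<close>. So induction reduces everything to three facts: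
  \<open>f\<^sub>1 > 0\<close> for nonconstant stable \<open>f\<close> with \<open>f\<^sub>0 > 0\<close> (\<open>stable_linear_coeff_pos\<close>), and a step
  preserves (\<open>stable_raise\<close>) and reflects (\<open>stable_raiseD\<close>) stability.

  All three come from one identity. For stable \<open>p\<close> the function \<open>\<phi>(z) = cnj (p(- cnj z)) / p(z)\<close> is a
  finite Blaschke product of the right half-plane, so its kernel
  \<open>(1 - \<phi>(z) cnj (\<phi>(w))) / (z + cnj w)\<close> is positive definite. With denominators cleared, this kernel is
  an explicit sum of \<open>deg p\<close> terms \<open>q\<^sub>k(z) cnj (q\<^sub>k(w))\<close> (\<open>stable_kernel_decomposition\<close>).
  On the diagonal it gives \<open>\<bar>f(-z)\<bar> \<le> \<bar>f(z)\<bar>\<close> for real stable \<open>f\<close> and \<open>Re z > 0\<close>; the Cauchy-Schwarz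
  inequality between the points \<open>z\<close> and \<open>0\<close> sharpens this to \<open>stable_boundary_Schwarz\<close>, a form of
  Julia's boundary Schwarz lemma. In terms of the even and odd parts of \<open>f\<close> the latter reads
  \<open>Re (f\<^sub>e(z) / f\<^sub>o(z)) \<ge> Re (c / z)\<close> with \<open>c = f\<^sub>0 / f\<^sub>1\<close>, for \<open>Re z > 0\<close> and \<open>f\<^sub>o(z) \<noteq> 0\<close>. Undoing a
  step subtracts \<open>c / z\<close>, that is \<open>g\<^sub>o / g\<^sub>e = f\<^sub>e / f\<^sub>o - c / z\<close>; so this quotient has nonnegative real
  part, whereas a root of \<open>g\<close> would make it \<open>-1\<close>.
\<close>

section \<open>A positive kernel for stable polynomials\<close>

lemma hurwitz_stable_nonzero: "hurwitz_stable p \<Longrightarrow> p \<noteq> 0"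
  unfolding hurwitz_stable_def by (metis poly_0 zero_complex.simps(1) less_irrefl)

text \<open>
  Induction on the roots. If \<open>p = (z - a) h\<close>, then the kernel of \<open>p\<close> is the kernel of \<open>h\<close> conjugated by
  the reflected factor \<open>z + cnj a\<close>, plus \<open>-2 Re a\<close> times \<open>h(z) cnj (h(w))\<close>. Stability enters only
  through the sign of \<open>-2 Re a\<close>, which has to be a square for the new term to have the required form.
\<close>

lemma stable_kernel_decomposition:
  fixes p :: "complex poly"
  assumes "hurwitz_stable p"
  shows "\<exists>q :: nat \<Rightarrow> complex poly. \<forall>z w.
           poly p z * cnj (poly p w) - cnj (poly p (- cnj z)) * poly p (- cnj w) =
           (z + cnj w) * (\<Sum>k<degree p. poly (q k) z * cnj (poly (q k) w))"
  using assms
proof (induction "degree p" arbitrary: p)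
  case 0
  then obtain b where "p = [:b:]"
    by (metis degree_eq_zeroE)
  then show ?case
    by (simp add: mult.commute)
next
  case (Suc n)
  have "\<not> constant (poly p)"
    using Suc.hyps(2) by (simp add: constant_degree)
  then obtain a where a: "poly p a = 0"
    using fundamental_theorem_of_algebra by blast
  then obtain h where h: "p = [:- a, 1:] * h"
    using poly_eq_0_iff_dvd by (metis dvdE)
  have "Re a < 0"
    using a Suc.prems by (simp add: hurwitz_stable_def)
  have "p \<noteq> 0"
    using Suc.prems by (rule hurwitz_stable_nonzero)
  then have deg: "degree p = Suc (degree h)"
    unfolding h by (subst degree_mult_eq) auto
  have "hurwitz_stable h"
    using Suc.prems by (auto simp: hurwitz_stable_def h)
  moreover have "n = degree h"
    using Suc.hyps(2) deg by simp
  ultimately obtain q :: "nat \<Rightarrow> complex poly" where q: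
    "\<And>z w. poly h z * cnj (poly h w) - cnj (poly h (- cnj z)) * poly h (- cnj w) =
       (z + cnj w) * (\<Sum>k<degree h. poly (q k) z * cnj (poly (q k) w))"
    using Suc.hyps(1)[of h] by auto
  define s where "s = complex_of_real (sqrt (- 2 * Re a))"
  have s: "s * cnj s = - (a + cnj a)"
    using \<open>Re a < 0\<close> by (simp add: s_def complex_add_cnj flip: of_real_mult)
  define q' where "q' k = (if k < degree h then [:cnj a, 1:] * q k else smult s h)" for k
  have "poly p z * cnj (poly p w) - cnj (poly p (- cnj z)) * poly p (- cnj w) =
        (z + cnj w) * (\<Sum>k<degree p. poly (q' k) z * cnj (poly (q' k) w))" for z w
  proof -
    have sum_split: "(\<Sum>k<degree p. poly (q' k) z * cnj (poly (q' k) w)) =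
          (z + cnj a) * (cnj w + a) * (\<Sum>k<degree h. poly (q k) z * cnj (poly (q k) w))
          + (s * cnj s) * (poly h z * cnj (poly h w))"
      by (simp add: deg q'_def sum_distrib_left sum.distrib algebra_simps)
    have "poly p z * cnj (poly p w) - cnj (poly p (- cnj z)) * poly p (- cnj w) =
          (z - a) * (cnj w - cnj a) * (poly h z * cnj (poly h w))
          - (z + cnj a) * (cnj w + a) * (cnj (poly h (- cnj z)) * poly h (- cnj w))"
      by (simp add: h algebra_simps)
    also have "\<dots> = (z + cnj a) * (cnj w + a) *
          (poly h z * cnj (poly h w) - cnj (poly h (- cnj z)) * poly h (- cnj w))
          + (z + cnj w) * (- (a + cnj a)) * (poly h z * cnj (poly h w))"
      by (simp add: algebra_simps)
    also have "\<dots> = (z + cnj w) * ((z + cnj a) * (cnj w + a) *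
          (\<Sum>k<degree h. poly (q k) z * cnj (poly (q k) w))
          + (s * cnj s) * (poly h z * cnj (poly h w)))"
      unfolding q s by (simp only: distrib_left mult_ac)
    also have "\<dots> = (z + cnj w) * (\<Sum>k<degree p. poly (q' k) z * cnj (poly (q' k) w))"
      unfolding sum_split by (simp add: mult_ac)
    finally show ?thesis .
  qed
  then show ?case by blast
qed

lemma Cauchy_Schwarz_complex_sum:
  fixes u v :: "'a \<Rightarrow> complex"
  shows "(cmod (\<Sum>i\<in>I. u i * cnj (v i)))\<^sup>2 \<le> (\<Sum>i\<in>I. (cmod (u i))\<^sup>2) * (\<Sum>i\<in>I. (cmod (v i))\<^sup>2)"
proof -
  have "cmod (\<Sum>i\<in>I. u i * cnj (v i)) \<le> (\<Sum>i\<in>I. cmod (u i) * cmod (v i))"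
    by (rule order_trans[OF norm_sum]) (simp add: norm_mult)
  then have "(cmod (\<Sum>i\<in>I. u i * cnj (v i)))\<^sup>2 \<le> (\<Sum>i\<in>I. cmod (u i) * cmod (v i))\<^sup>2"
    by (intro power_mono) auto
  also note Cauchy_Schwarz_ineq_sum
  finally show ?thesis .
qed

section \<open>Real stable polynomials in the right half-plane\<close>

abbreviation cpoly :: "real poly \<Rightarrow> complex \<Rightarrow> complex" where
  "cpoly f \<equiv> poly (map_poly complex_of_real f)"

lemma cpoly_cnj: "cnj (cpoly f z) = cpoly f (cnj z)"
  by (rule poly_cnj_real) (simp add: coeff_map_poly)

lemma cpoly_0: "cpoly f 0 = complex_of_real (coeff f 0)"
  by (simp add: poly_0_coeff_0 coeff_map_poly)

text \<open>
  For real \<open>f\<close> the reflection \<open>cnj (f(- cnj z))\<close> is \<open>f(-z)\<close>. The first bound is nonnegativity of the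
  kernel \<open>K\<close> at \<open>(z, z)\<close>. The second is \<open>\<bar>K(z, 0)\<bar>\<^sup>2 \<le> K(z, z) K(0, 0)\<close>, where
  \<open>K(z, z) = (\<bar>f(z)\<bar>\<^sup>2 - \<bar>f(-z)\<bar>\<^sup>2) / (2 Re z)\<close>, \<open>K(z, 0) = f\<^sub>0 (f(z) - f(-z)) / z\<close> and
  \<open>K(0, 0) = 2 f\<^sub>0 f\<^sub>1\<close>.
\<close>

lemma stable_reflection_bounds:
  fixes f :: "real poly"
  assumes stable: "hurwitz_stable (map_poly complex_of_real f)"
    and f0: "coeff f 0 > 0" and z: "Re z > 0"
  shows stable_reflection_le: "cmod (cpoly f (- z)) \<le> cmod (cpoly f z)"
    and stable_boundary_Schwarz:
      "coeff f 0 * Re z * (cmod (cpoly f z - cpoly f (- z)))\<^sup>2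
         \<le> coeff f 1 * (cmod z)\<^sup>2 * ((cmod (cpoly f z))\<^sup>2 - (cmod (cpoly f (- z)))\<^sup>2)"
proof -
  define F where "F = map_poly complex_of_real f"
  define n where "n = degree F"
  have cnjF: "cnj (poly F u) = poly F (cnj u)" for u
    unfolding F_def by (rule cpoly_cnj)
  obtain q :: "nat \<Rightarrow> complex poly" where q:
    "\<And>u w. poly F u * cnj (poly F w) - poly F (- u) * cnj (poly F (- w)) =
       (u + cnj w) * (\<Sum>k<n. poly (q k) u * cnj (poly (q k) w))"
    using stable_kernel_decomposition[OF stable, folded F_def n_def] by (auto simp: cnjF)
  define S where "S = (\<Sum>k<n. (cmod (poly (q k) z))\<^sup>2)"
  define S0 where "S0 = (\<Sum>k<n. (cmod (poly (q k) 0))\<^sup>2)"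
  have "S \<ge> 0"
    unfolding S_def by (intro sum_nonneg) auto
  have "complex_of_real ((cmod (poly F z))\<^sup>2 - (cmod (poly F (- z)))\<^sup>2) = complex_of_real (2 * Re z * S)"
    using q[of z z] by (simp add: S_def complex_add_cnj flip: complex_norm_square)
  then have diag: "(cmod (poly F z))\<^sup>2 - (cmod (poly F (- z)))\<^sup>2 = 2 * Re z * S"
    using of_real_eq_iff by blast
  show "cmod (cpoly f (- z)) \<le> cmod (cpoly f z)"
  proof (rule power2_le_imp_le)
    have "2 * Re z * S \<ge> 0"
      using z \<open>S \<ge> 0\<close> by simp
    then show "(cmod (cpoly f (- z)))\<^sup>2 \<le> (cmod (cpoly f z))\<^sup>2"
      using diag unfolding F_def by linarith
  qed simp
  \<comment> \<open>The kernel as a polynomial in its first variable, with the second at the origin.\<close>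
  define T where "T = (\<Sum>k<n. smult (cnj (poly (q k) 0)) (q k))"
  have T: "poly T u = (\<Sum>k<n. poly (q k) u * cnj (poly (q k) 0))" for u
    by (simp add: T_def poly_sum mult.commute)
  have F0: "poly F 0 = complex_of_real (coeff f 0)"
    unfolding F_def by (rule cpoly_0)
  have T_eq: "u * poly T u = coeff f 0 * (poly F u - poly F (- u))" for u
    using q[of u 0] by (simp add: T F0 algebra_simps)
  \<comment> \<open>At \<open>u = 0\<close> this identity is void, so the value of \<open>T\<close> there comes from the coefficients.\<close>
  have "pCons 0 T = smult (complex_of_real (coeff f 0)) (F - pcompose F [:0, -1:])"
    by (rule poly_ext) (simp add: T_eq poly_pcompose)
  then have "coeff (pCons 0 T) 1 = coeff (smult (complex_of_real (coeff f 0)) (F - pcompose F [:0, -1:])) 1"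
    by simp
  then have T0: "poly T 0 = complex_of_real (2 * coeff f 0 * coeff f 1)"
    by (simp add: coeff_pcompose_linear F_def coeff_map_poly poly_0_coeff_0 coeff_pCons)
  have "complex_of_real S0 = poly T 0"
    by (simp add: T S0_def flip: complex_norm_square)
  then have S0: "S0 = 2 * coeff f 0 * coeff f 1"
    unfolding T0 using of_real_eq_iff by blast
  define D where "D = (cmod (poly F z - poly F (- z)))\<^sup>2"
  have "(coeff f 0)\<^sup>2 * D = (cmod z)\<^sup>2 * (cmod (poly T z))\<^sup>2"
    using arg_cong[OF T_eq[of z], of "\<lambda>x. (cmod x)\<^sup>2"] f0
    by (simp add: norm_mult power_mult_distrib D_def)
  also have "\<dots> \<le> (cmod z)\<^sup>2 * (S * S0)"
    unfolding T S_def S0_def by (intro mult_left_mono Cauchy_Schwarz_complex_sum) auto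
  finally have "coeff f 0 * (coeff f 0 * D) \<le> coeff f 0 * ((cmod z)\<^sup>2 * S * (2 * coeff f 1))"
    by (simp add: S0 power2_eq_square mult_ac)
  then have "coeff f 0 * D \<le> (cmod z)\<^sup>2 * S * (2 * coeff f 1)"
    using f0 by simp
  then have "Re z * (coeff f 0 * D) \<le> Re z * ((cmod z)\<^sup>2 * S * (2 * coeff f 1))"
    using z by simp
  then have "coeff f 0 * Re z * D \<le> coeff f 1 * (cmod z)\<^sup>2 * (2 * Re z * S)"
    by (simp add: mult_ac)
  then show "coeff f 0 * Re z * (cmod (cpoly f z - cpoly f (- z)))\<^sup>2
         \<le> coeff f 1 * (cmod z)\<^sup>2 * ((cmod (cpoly f z))\<^sup>2 - (cmod (cpoly f (- z)))\<^sup>2)"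
    unfolding diag[symmetric] D_def F_def .
qed

text \<open>
  If \<open>f\<^sub>1 \<le> 0\<close>, the boundary inequality forces \<open>f(z) = f(-z)\<close> on the right half-plane, so a root in the
  left half-plane would be mirrored to one in the right half-plane.
\<close>

lemma stable_linear_coeff_pos:
  fixes f :: "real poly"
  assumes stable: "hurwitz_stable (map_poly complex_of_real f)"
    and f0: "coeff f 0 > 0" and deg: "degree f > 0"
  shows "coeff f 1 > 0"
proof (rule ccontr)
  assume neg: "\<not> coeff f 1 > 0"
  have "\<not> constant (cpoly f)"
    using deg by (simp add: constant_degree degree_map_poly)
  then obtain a where a: "cpoly f a = 0"
    using fundamental_theorem_of_algebra by blast
  then have z: "Re (- a) > 0"
    using stable by (simp add: hurwitz_stable_def)
  have "coeff f 1 * (cmod (- a))\<^sup>2 * ((cmod (cpoly f (- a)))\<^sup>2 - (cmod (cpoly f (- (- a))))\<^sup>2) \<le> 0"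
    using neg stable_reflection_le[OF stable f0 z]
    by (intro mult_nonpos_nonneg) (auto simp: mult_nonpos_nonneg)
  with stable_boundary_Schwarz[OF stable f0 z]
  have "coeff f 0 * Re (- a) * (cmod (cpoly f (- a) - cpoly f (- (- a))))\<^sup>2 \<le> 0"
    by (rule order_trans)
  moreover have "coeff f 0 * Re (- a) > 0"
    using f0 z by (rule mult_pos_pos)
  ultimately have "(cmod (cpoly f (- a) - cpoly f (- (- a))))\<^sup>2 \<le> 0"
    by (metis mult_le_cancel_left_pos mult_zero_right)
  then have "cpoly f (- a) = 0"
    using a by simp
  then show False
    using stable z unfolding hurwitz_stable_def by force
qed

section \<open>The degree-raising step and its effect on stability\<close>

definition even_part :: "real poly \<Rightarrow> real poly" where
  "even_part p = smult (1/2) (p + pcompose p [:0, -1:])"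

lemma coeff_even_part: "coeff (even_part p) i = (if even i then coeff p i else 0)"
  by (simp add: even_part_def coeff_pcompose_linear)

text \<open>The map on polynomials that corresponds to multiplying the Hurwitz matrix by \<open>J(c)\<close>.\<close>

definition raise :: "real \<Rightarrow> real poly \<Rightarrow> real poly" where
  "raise c g = pCons 0 g + smult c (even_part g)"

lemma coeff_raise:
  "coeff (raise c g) m = (if m = 0 then 0 else coeff g (m - 1)) + (if even m then c * coeff g m else 0)"
  by (auto simp: raise_def coeff_even_part coeff_pCons split: nat.splits)

lemma coeff_raise_0: "coeff (raise c g) 0 = c * coeff g 0"
  by (simp add: coeff_raise)

lemma coeff_raise_1: "coeff (raise c g) 1 = coeff g 0"
  by (simp add: coeff_raise)

lemma degree_raise: "g \<noteq> 0 \<Longrightarrow> degree (raise c g) = Suc (degree g)"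
proof -
  assume "g \<noteq> 0"
  have "degree (smult c (even_part g)) \<le> degree g"
    by (rule degree_le) (auto simp: coeff_even_part coeff_eq_0)
  then show ?thesis
    unfolding raise_def using \<open>g \<noteq> 0\<close> by (subst degree_add_eq_left) auto
qed

lemma cpoly_raise: "cpoly (raise c g) z = z * cpoly g z + c * (cpoly g z + cpoly g (- z)) / 2"
proof -
  have "map_poly complex_of_real (raise c g) =
      pCons 0 (map_poly complex_of_real g) + smult (c / 2)
        (map_poly complex_of_real g + pcompose (map_poly complex_of_real g) [:0, -1:])"
    by (rule poly_eqI)
      (auto simp: coeff_raise coeff_map_poly coeff_pCons coeff_pcompose_linear split: nat.splits)
  then show ?thesis
    by (simp add: poly_pcompose)
qed

text \<open>
  Write \<open>f(z) = (z + c/2) g(z) + (c/2) g(-z)\<close>. For \<open>Re z \<ge> 0\<close> the second term is at most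
  \<open>(c/2) \<bar>g(z)\<bar>\<close> in modulus, and \<open>\<bar>z + c/2\<bar>\<close> exceeds \<open>c/2\<close> unless \<open>z = 0\<close>, so the terms cannot cancel;
  and \<open>f(0) = c g(0) \<noteq> 0\<close>.
\<close>

lemma stable_raise:
  assumes stable: "hurwitz_stable (map_poly complex_of_real g)"
    and g0: "coeff g 0 > 0" and c: "c > 0"
  shows "hurwitz_stable (map_poly complex_of_real (raise c g))"
  unfolding hurwitz_stable_def
proof (intro allI impI, rule ccontr)
  fix z assume root: "cpoly (raise c g) z = 0" and "\<not> Re z < 0"
  then have Re: "Re z \<ge> 0" by simp
  have "(z + c / 2) * cpoly g z + c / 2 * cpoly g (- z) = 0"
    using root by (simp add: cpoly_raise algebra_simps add_divide_distrib)
  then have "(z + c / 2) * cpoly g z = - (c / 2 * cpoly g (- z))"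
    by (simp add: eq_neg_iff_add_eq_0)
  then have eq: "cmod (z + c / 2) * cmod (cpoly g z) = c / 2 * cmod (cpoly g (- z))"
    using c by (metis norm_minus_cancel norm_mult norm_of_real abs_of_pos half_gt_zero
        of_real_divide of_real_numeral)
  have gz: "cmod (cpoly g z) > 0"
    using stable Re unfolding hurwitz_stable_def by force
  have "cmod (cpoly g (- z)) \<le> cmod (cpoly g z)"
  proof (cases "Re z = 0")
    case True
    \<comment> \<open>On the imaginary axis reflection is conjugation, and \<open>g\<close> is real.\<close>
    then have "- z = cnj z" by (simp add: complex_eq_iff)
    then show ?thesis by (metis cpoly_cnj complex_mod_cnj order_refl)
  next
    case False
    then show ?thesis using stable_reflection_le[OF stable g0] Re by simp
  qed
  then have "cmod (z + c / 2) * cmod (cpoly g z) \<le> c / 2 * cmod (cpoly g z)"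
    unfolding eq using c by simp
  then have "cmod (z + c / 2) \<le> c / 2"
    using gz by simp
  then have "(cmod (z + c / 2))\<^sup>2 \<le> (c / 2)\<^sup>2"
    by (intro power_mono) auto
  then have "(Re z)\<^sup>2 + (Im z)\<^sup>2 + c * Re z \<le> 0"
    unfolding cmod_power2 by (simp add: power2_eq_square algebra_simps)
  moreover have "c * Re z \<ge> 0"
    using c Re by simp
  ultimately have "(Re z)\<^sup>2 + (Im z)\<^sup>2 \<le> 0"
    by linarith
  then have "z = 0"
    by (simp add: complex_eq_iff sum_power2_le_zero_iff)
  then show False
    using root c g0 by (simp add: cpoly_0 coeff_raise_0)
qed

text \<open>
  Let \<open>g(z) = 0\<close> with \<open>Re z \<ge> 0\<close> and put \<open>E = g\<^sub>e(z)\<close>. Then \<open>f(z) = c E\<close> and \<open>f(-z) = (c - 2z) E\<close>, so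
  \<open>E \<noteq> 0\<close> because \<open>f\<close> is stable. On the imaginary axis \<open>E\<close> vanishes with \<open>g(z)\<close> as \<open>g\<close> is real. For
  \<open>Re z > 0\<close>, substitution into \<open>stable_boundary_Schwarz\<close> makes the terms with \<open>Re z\<close> cancel, as
  \<open>f\<^sub>0 = c g\<^sub>0\<close> and \<open>f\<^sub>1 = g\<^sub>0\<close>; what remains is \<open>g\<^sub>0 \<bar>z\<bar>\<^sup>4 \<bar>E\<bar>\<^sup>2 \<le> 0\<close>. The cruder bound
  \<open>\<bar>f(-z)\<bar> \<le> \<bar>f(z)\<bar>\<close> would not exclude roots in the disc \<open>\<bar>c - 2z\<bar> \<le> c\<close>.
\<close>

lemma stable_raiseD:
  assumes stable: "hurwitz_stable (map_poly complex_of_real (raise c g))"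
    and g0: "coeff g 0 > 0" and c: "c > 0"
  shows "hurwitz_stable (map_poly complex_of_real g)"
  unfolding hurwitz_stable_def
proof (intro allI impI, rule ccontr)
  fix z assume root: "cpoly g z = 0" and "\<not> Re z < 0"
  then have Re: "Re z \<ge> 0" by simp
  have raise_ne: "cpoly (raise c g) z \<noteq> 0"
    using stable Re unfolding hurwitz_stable_def by force
  define E where "E = cpoly g (- z) / 2"
  have f: "cpoly (raise c g) z = c * E"
    by (simp add: cpoly_raise root E_def)
  have f': "cpoly (raise c g) (- z) = (c - 2 * z) * E"
    by (simp add: cpoly_raise root E_def field_simps)
  have "E \<noteq> 0"
    using raise_ne f by auto
  have "Re z \<noteq> 0"
  proof
    assume "Re z = 0"
    then have "- z = cnj z" by (simp add: complex_eq_iff)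
    then have "cpoly g (- z) = cnj (cpoly g z)" by (simp add: cpoly_cnj)
    then show False
      using \<open>E \<noteq> 0\<close> root by (simp add: E_def)
  qed
  with Re have Re': "Re z > 0" by simp
  then have "(cmod z)\<^sup>2 > 0" by auto
  have diff: "cpoly (raise c g) z - cpoly (raise c g) (- z) = 2 * z * E"
    unfolding f f' by (simp add: algebra_simps)
  have "(cmod (complex_of_real c - 2 * z))\<^sup>2 = c\<^sup>2 - 4 * c * Re z + 4 * (cmod z)\<^sup>2"
    unfolding cmod_power2 by (simp add: power2_eq_square algebra_simps)
  then have "(cmod (cpoly (raise c g) z))\<^sup>2 - (cmod (cpoly (raise c g) (- z)))\<^sup>2
        = (4 * c * Re z - 4 * (cmod z)\<^sup>2) * (cmod E)\<^sup>2"
    unfolding f f' norm_mult power_mult_distrib by (simp add: left_diff_distrib distrib_right)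
  moreover have "coeff (raise c g) 0 > 0"
    using c g0 by (simp add: coeff_raise_0)
  ultimately have "c * coeff g 0 * Re z * (4 * (cmod z)\<^sup>2 * (cmod E)\<^sup>2)
      \<le> coeff g 0 * (cmod z)\<^sup>2 * ((4 * c * Re z - 4 * (cmod z)\<^sup>2) * (cmod E)\<^sup>2)"
    using stable_boundary_Schwarz[OF stable _ Re']
    unfolding diff coeff_raise_0 coeff_raise_1 by (simp add: norm_mult power_mult_distrib)
  then have "coeff g 0 * (cmod z)\<^sup>2 * (4 * (cmod z)\<^sup>2) * (cmod E)\<^sup>2 \<le> 0"
    by (simp add: algebra_simps)
  moreover have "coeff g 0 * (cmod z)\<^sup>2 * (4 * (cmod z)\<^sup>2) * (cmod E)\<^sup>2 > 0"
    using g0 \<open>(cmod z)\<^sup>2 > 0\<close> \<open>E \<noteq> 0\<close> by (intro mult_pos_pos) auto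
  ultimately show False by simp
qed

text \<open>
  The odd coefficients of \<open>f\<close> are the even ones of \<open>g\<close> shifted by one. Once they are known, so is
  \<open>g\<^sub>e\<close>, and \<open>f - c g\<^sub>e\<close> must be divisible by \<open>x\<close>, which forces \<open>c = f\<^sub>0 / f\<^sub>1\<close>.
\<close>

lemma raise_surj:
  fixes f :: "real poly"
  assumes "coeff f 1 \<noteq> 0"
  defines "c \<equiv> coeff f 0 / coeff f 1"
  defines "g \<equiv> poly_shift 1 (f - smult c (even_part (poly_shift 1 f)))"
  shows "raise c g = f"
proof (rule poly_eqI)
  fix m
  show "coeff (raise c g) m = coeff f m"
    using assms(1)
    by (cases m) (auto simp: coeff_raise g_def c_def coeff_poly_shift coeff_even_part)
qed

section \<open>Factorizations\<close>

lemma stable_foldr_raise: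
  assumes "\<forall>c\<in>set cs. c > 0" and "b > 0"
  shows "hurwitz_stable (map_poly complex_of_real (foldr raise cs [:b:])) \<and>
         coeff (foldr raise cs [:b:]) 0 > 0"
  using assms
proof (induction cs)
  case Nil
  then show ?case by (simp add: hurwitz_stable_def map_poly_pCons)
next
  case (Cons c cs)
  then show ?case by (simp add: stable_raise coeff_raise_0)
qed

lemma stable_imp_foldr_raise:
  fixes f :: "real poly"
  assumes "hurwitz_stable (map_poly complex_of_real f)" and "coeff f 0 > 0"
  shows "\<exists>cs b. length cs = degree f \<and> (\<forall>c\<in>set cs. c > 0) \<and> b > 0 \<and> f = foldr raise cs [:b:]"
  using assms
proof (induction "degree f" arbitrary: f)
  case 0
  then obtain b where "f = [:b:]"
    by (metis degree_eq_zeroE)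
  with 0 show ?case
    by (intro exI[of _ "[]"] exI[of _ b]) simp
next
  case (Suc n)
  have f1: "coeff f 1 > 0"
    using stable_linear_coeff_pos Suc by simp
  define c where "c = coeff f 0 / coeff f 1"
  obtain g where f: "f = raise c g"
    unfolding c_def using raise_surj f1 by (metis less_irrefl)
  have c: "c > 0"
    using f1 Suc.prems by (simp add: c_def)
  have g0: "coeff g 0 > 0"
    using f1 unfolding f coeff_raise_1 .
  then have "g \<noteq> 0" by auto
  then have deg: "degree f = Suc (degree g)"
    unfolding f by (rule degree_raise)
  have "hurwitz_stable (map_poly complex_of_real g)"
    using Suc.prems(1) g0 c unfolding f by (rule stable_raiseD)
  moreover have "n = degree g"
    using Suc.hyps(2) deg by simp
  ultimately obtain cs b
    where "length cs = degree g" "\<forall>c\<in>set cs. c > 0" "b > 0" "g = foldr raise cs [:b:]"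
    using Suc.hyps(1)[of g] g0 by blast
  then show ?case
    using c deg f by (intro exI[of _ "c # cs"] exI[of _ b]) simp
qed

section \<open>Translation to Hurwitz matrices\<close>

lemma J_matrix_mult:
  "(J_matrix c \<odot>\<^sub>\<infinity> M) i j = (if even i then c * M i j else 0) + M (i + 1) j"
proof -
  have "(J_matrix c \<odot>\<^sub>\<infinity> M) i j = (\<Sum>k\<in>{i, i + 1}. J_matrix c i k * M k j)"
    unfolding inf_matrix_mult_def
    by (rule sum.mono_neutral_left) (auto simp: J_matrix_def split: if_splits)
  then show ?thesis
    by (simp add: J_matrix_def)
qed

text \<open>
  The entry \<open>(i, j)\<close> of \<open>H(g)\<close> is \<open>g\<^sub>m\<close> with \<open>m = 2j - i\<close>, and moving down a row lowers \<open>m\<close> by one. Since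
  \<open>i\<close> and \<open>m\<close> have the same parity, \<open>J(c)\<close> adds \<open>c g\<^sub>m\<close> to \<open>g\<^sub>m\<^sub>-\<^sub>1\<close> exactly for even \<open>m\<close>.
\<close>

lemma hurwitz_matrix_raise: "hurwitz_matrix (raise c g) = J_matrix c \<odot>\<^sub>\<infinity> hurwitz_matrix g"
proof (intro ext)
  fix i j
  show "hurwitz_matrix (raise c g) i j = (J_matrix c \<odot>\<^sub>\<infinity> hurwitz_matrix g) i j"
  proof (cases "2 * j \<ge> i")
    case True
    then obtain m where m: "2 * j = i + m"
      using le_Suc_ex by blast
    then have "2 * int j = int i + int m" "even m \<longleftrightarrow> even i"
      by (presburger, metis even_add even_mult_iff even_numeral)
    then show ?thesis
      by (auto simp: J_matrix_mult hurwitz_matrix_def int_coeff_def coeff_raise nat_diff_distrib)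
  next
    case False
    then show ?thesis
      by (auto simp: J_matrix_mult hurwitz_matrix_def int_coeff_def)
  qed
qed

lemma hurwitz_matrix_foldr_raise:
  "hurwitz_matrix (foldr raise cs p) = foldr (\<lambda>c M. J_matrix c \<odot>\<^sub>\<infinity> M) cs (hurwitz_matrix p)"
  by (induction cs) (simp_all add: hurwitz_matrix_raise)

lemma hurwitz_matrix_inject: "hurwitz_matrix p = hurwitz_matrix q \<longleftrightarrow> p = q"
proof
  assume eq: "hurwitz_matrix p = hurwitz_matrix q"
  show "p = q"
  proof (rule poly_eqI)
    fix m
    \<comment> \<open>The diagonal of \<open>H(r)\<close> lists the coefficients of \<open>r\<close>, as \<open>2m - m = m\<close>.\<close>
    have "coeff r m = hurwitz_matrix r m m" for r
      by (simp add: hurwitz_matrix_def int_coeff_def)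
    with eq show "coeff p m = coeff q m" by simp
  qed
qed simp

theorem theorem3:
  fixes f :: "real poly" and n :: nat
  assumes "degree f = n" and "coeff f 0 > 0"
  shows "hurwitz_stable (map_poly complex_of_real f) \<longleftrightarrow>
    (\<exists>(c :: nat \<Rightarrow> real) (b :: real). (\<forall>j\<in>{1..n}. c j > 0) \<and> b > 0 \<and>
       hurwitz_matrix f = foldr (\<lambda>j M. J_matrix (c j) \<odot>\<^sub>\<infinity> M) [1..<n + 1] (hurwitz_matrix [:b:]))"
proof -
  have factorization: "hurwitz_matrix f = foldr (\<lambda>j M. J_matrix (c j) \<odot>\<^sub>\<infinity> M) xs (hurwitz_matrix [:b:])
      \<longleftrightarrow> f = foldr raise (map c xs) [:b:]" for c :: "nat \<Rightarrow> real" and b xs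
  proof -
    have "foldr (\<lambda>j M. J_matrix (c j) \<odot>\<^sub>\<infinity> M) xs (hurwitz_matrix [:b:])
        = hurwitz_matrix (foldr raise (map c xs) [:b:])"
      unfolding hurwitz_matrix_foldr_raise by (simp add: foldr_map comp_def)
    then show ?thesis
      by (simp only: hurwitz_matrix_inject)
  qed
  show ?thesis
    unfolding factorization
  proof
    assume "hurwitz_stable (map_poly complex_of_real f)"
    then obtain cs b where cs: "length cs = n" "\<forall>c\<in>set cs. c > 0" "b > 0" "f = foldr raise cs [:b:]"
      using stable_imp_foldr_raise assms by blast
    \<comment> \<open>The parameters are numbered from 1, list positions from 0.\<close>
    define c where "c j = cs ! (j - 1)" for j
    have "map c [1..<n + 1] = cs"
      by (rule nth_equalityI) (simp_all add: c_def cs(1) del: upt_Suc)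
    moreover have "\<forall>j\<in>{1..n}. c j > 0"
      using cs by (auto simp: c_def)
    ultimately show "\<exists>c b. (\<forall>j\<in>{1..n}. c j > 0) \<and> b > 0 \<and> f = foldr raise (map c [1..<n + 1]) [:b:]"
      using cs by (intro exI[of _ c] exI[of _ b]) simp
  next
    assume "\<exists>c b. (\<forall>j\<in>{1..n}. c j > 0) \<and> b > 0 \<and> f = foldr raise (map c [1..<n + 1]) [:b:]"
    then show "hurwitz_stable (map_poly complex_of_real f)"
      using stable_foldr_raise by (fastforce simp del: upt_Suc)
  qed
qed

end
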